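(* Let $\lambda>0$ and $r>0$ be fixed. Let $P^c_n$ and $P^c_n(D)$ denote the probability that the exponential, respectively double exponential, random geometric graph with $n$ vertices, parameter $\lambda$ and cutoff $r$ is connected. Then there is a real number $P^c$ with $0<P^c<1$ such that 1. $\lim_{n\to\infty}P^c_n=P^c$; 2. $\lim_{n\to\infty}P^c_n(D)=(P^c)^2$.
   Context: The exponential (respectively double exponential) random geometric graph with $n$ vertices, parameter $\lambda$ and cutoff $r$ is the random graph with vertex set $\{X_1,\dots,X_n\}$, where the $X_i$ are i.i.d. real random variables with density $\lambda e^{-\lambda x}$, $x>0$ (respectively $\frac{\lambda}{2}e^{-\lambda|x|}$, $x\in\mathbb{R}$), and with an edge between $X_i$ and $X_j$ ($i\ne j$) if and only if $|X_i-X_j|\le r$. *)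

theory Defs
  imports "HOL-Probability.Probability" "Graph_Theory.Digraph_Component"
begin

text \<open>
  The geometric graph on points \<open>x 1, \<dots>, x n\<close> with cutoff \<open>r\<close>. The vertices are the
  indices, so that there are always exactly \<open>n\<close> of them. A simple undirected graph is
  a symmetric irreflexive set of arcs (see \<open>geometric_graph_is_graph\<close>).
\<close>

definition geometric_graph :: "nat \<Rightarrow> real \<Rightarrow> (nat \<Rightarrow> real) \<Rightarrow> nat pair_pre_digraph" where
  "geometric_graph n r x =
     \<lparr> pverts = {1..n},
       parcs = {(i, j). i \<in> {1..n} \<and> j \<in> {1..n} \<and> i \<noteq> j \<and> \<bar>x i - x j\<bar> \<le> r} \<rparr>"

definition double_exponential_density :: "real \<Rightarrow> real \<Rightarrow> real" where
  "double_exponential_density l x = l / 2 * exp (- l * \<bar>x\<bar>)"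

text \<open>
  \<open>points_measure f n\<close> is the joint law on \<open>\<real>\<^sup>n\<close> of \<open>n\<close> i.i.d. real random variables with
  density \<open>f\<close>. Taking it as the underlying probability space loses no generality: see
  \<open>prob_connected_iid\<close>. The name \<open>connected\<close> is qualified because the topological notion
  has the same name.
\<close>

definition points_measure :: "(real \<Rightarrow> real) \<Rightarrow> nat \<Rightarrow> (nat \<Rightarrow> real) measure" where
  "points_measure f n = (\<Pi>\<^sub>M i\<in>{1..n}. density lborel (\<lambda>t. ennreal (f t)))"

definition prob_rgg_connected :: "(real \<Rightarrow> real) \<Rightarrow> nat \<Rightarrow> real \<Rightarrow> real" where
  "prob_rgg_connected f n r =
     measure (points_measure f n)
       {x \<in> space (points_measure f n).
          Digraph_Component.connected (with_proj (geometric_graph n r x))}"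

lemma geometric_graph_is_graph: "pair_graph (geometric_graph n r x)"
proof
  show "finite (parcs (geometric_graph n r x))"
    by (rule finite_subset[of _ "{1..n} \<times> {1..n}"]) (auto simp: geometric_graph_def)
qed (auto simp: geometric_graph_def symmetric_def arcs_ends_conv sym_def abs_minus_commute)

lemma geometric_graph_cong:
  assumes "\<And>i. i \<in> {1..n} \<Longrightarrow> x i = y i"
  shows "geometric_graph n r x = geometric_graph n r y"
  using assms by (auto simp: geometric_graph_def)

lemma measurable_geometric_graph_connected:
  "{x \<in> space (\<Pi>\<^sub>M i\<in>{1..n}. borel).
      Digraph_Component.connected (with_proj (geometric_graph n r x))}
     \<in> sets (\<Pi>\<^sub>M i\<in>{1..n}. (borel :: real measure))" (is "{x \<in> space ?B. ?C x} \<in> _")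
proof -
  let ?I = "{1..n}"
  define E where "E x = parcs (geometric_graph n r x)" for x
  let ?S = "{A. A \<subseteq> ?I \<times> ?I \<and>
    Digraph_Component.connected (with_proj \<lparr>pverts = ?I, parcs = A\<rparr>)}"
  have E_sub: "E x \<subseteq> ?I \<times> ?I" for x by (auto simp: E_def geometric_graph_def)
  have G: "geometric_graph n r x = \<lparr>pverts = ?I, parcs = E x\<rparr>" for x
    by (simp add: E_def geometric_graph_def)
  have arc: "{x \<in> space ?B. p \<in> E x} \<in> sets ?B" if "p \<in> ?I \<times> ?I" for p
  proof -
    have [measurable]: "(\<lambda>x. x (fst p)) \<in> borel_measurable ?B" "(\<lambda>x. x (snd p)) \<in> borel_measurable ?B"
      using that by (auto intro!: measurable_component_singleton)
    have "{x \<in> space ?B. p \<in> E x}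
        = {x \<in> space ?B. fst p \<noteq> snd p \<and> \<bar>x (fst p) - x (snd p)\<bar> \<le> r}"
      using that by (auto simp: E_def geometric_graph_def)
    also have "\<dots> \<in> sets ?B" by measurable
    finally show ?thesis .
  qed
  have "{x \<in> space ?B. E x = A} \<in> sets ?B" if "A \<subseteq> ?I \<times> ?I" for A
  proof -
    have "{x \<in> space ?B. E x = A} = {x \<in> space ?B. \<forall>p\<in>?I \<times> ?I. p \<in> E x \<longleftrightarrow> p \<in> A}"
      using that E_sub by blast
    also have "\<dots> \<in> sets ?B"
    proof (intro sets.sets_Collect_finite_All)
      fix p assume "p \<in> ?I \<times> ?I"
      then show "{x \<in> space ?B. p \<in> E x \<longleftrightarrow> p \<in> A} \<in> sets ?B"
        using arc[of p] sets.sets_Collect_neg[of ?B "\<lambda>x. p \<in> E x"] by (cases "p \<in> A") auto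
    qed simp
    finally show ?thesis .
  qed
  moreover have "{x \<in> space ?B. ?C x} = (\<Union>A\<in>?S. {x \<in> space ?B. E x = A})"
    using E_sub by (auto simp: G)
  moreover have "finite ?S"
    by (rule finite_subset[of _ "Pow (?I \<times> ?I)"]) auto
  ultimately show ?thesis by auto
qed

lemma prob_connected_iid:
  fixes M :: "'a measure" and X :: "nat \<Rightarrow> 'a \<Rightarrow> real" and f :: "real \<Rightarrow> real"
  assumes M: "prob_space M"
    and indep: "prob_space.indep_vars M (\<lambda>_. borel) X {1..n}"
    and dens: "\<And>i. i \<in> {1..n} \<Longrightarrow> distributed M lborel (X i) (\<lambda>t. ennreal (f t))"
  shows "measure M {\<omega> \<in> space M.
      Digraph_Component.connected (with_proj (geometric_graph n r (\<lambda>i. X i \<omega>)))}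
    = prob_rgg_connected f n r"
proof (cases "n = 0")
  case True
  then show ?thesis
    by (simp add: prob_rgg_connected_def geometric_graph_def Digraph_Component.connected_def
        strongly_connected_def mk_symmetric_def)
next
  case False
  interpret prob_space M by fact
  let ?I = "{1..n}"
  let ?B = "\<Pi>\<^sub>M i\<in>?I. (borel :: real measure)"
  let ?Y = "\<lambda>\<omega>. \<lambda>i\<in>?I. X i \<omega>"
  let ?C = "\<lambda>x. Digraph_Component.connected (with_proj (geometric_graph n r x))"
  have rv: "random_variable borel (X i)" if "i \<in> ?I" for i
    using dens[OF that] by (simp add: distributed_def)
  have "distr M ?B ?Y = (\<Pi>\<^sub>M i\<in>?I. distr M borel (X i))"
    using indep_vars_iff_distr_eq_PiM'[where I = ?I and M' = "\<lambda>_. borel" and X = X] rv indep False by auto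
  also have "\<dots> = points_measure f n"
    unfolding points_measure_def
  proof (intro PiM_cong refl)
    fix i assume "i \<in> ?I"
    have "distr M borel (X i) = distr M lborel (X i)"
      by (intro distr_cong) auto
    also have "\<dots> = density lborel (\<lambda>t. ennreal (f t))"
      using dens[OF \<open>i \<in> ?I\<close>] by (simp add: distributed_def)
    finally show "distr M borel (X i) = density lborel (\<lambda>t. ennreal (f t))" .
  qed
  finally have D: "points_measure f n = distr M ?B ?Y" ..
  have Y: "?Y \<in> measurable M ?B"
    by (intro measurable_restrict rv)
  have "prob_rgg_connected f n r = measure (distr M ?B ?Y) {x \<in> space ?B. ?C x}"
    by (simp add: prob_rgg_connected_def D)
  also have "\<dots> = prob (?Y -` {x \<in> space ?B. ?C x} \<inter> space M)"
    by (rule measure_distr[OF Y measurable_geometric_graph_connected])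
  also have "?Y -` {x \<in> space ?B. ?C x} \<inter> space M = {\<omega> \<in> space M. ?C (\<lambda>i. X i \<omega>)}"
  proof -
    have "geometric_graph n r (?Y \<omega>) = geometric_graph n r (\<lambda>i. X i \<omega>)" for \<omega>
      by (rule geometric_graph_cong) simp
    with measurable_space[OF Y] show ?thesis by auto
  qed
  finally show ?thesis ..
qed

end

theory Submission
  imports Defs
begin

text \<open>
  On the line the geometric graph is connected if and only if no two neighbouring points are more
  than \<open>r\<close> apart (\<open>connected_geometric_graph_iff_gap_free\<close>).

  Let \<open>q = exp (- l * r)\<close>. Since the exponential law has no memory, the gap above the lowest of
  \<open>n + 1\<close> exponential points is the minimum of \<open>n\<close> fresh exponential variables. It exceeds \<open>r\<close> with
  probability \<open>q ^ n\<close>, independently of whether the other \<open>n\<close> points are connected. Hence the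
  probability of connectedness is multiplied by \<open>1 - q ^ n\<close> in passing from \<open>n\<close> to \<open>n + 1\<close> points, and
  it equals the product of the factors \<open>1 - q ^ k\<close> with \<open>1 \<le> k < n\<close>. The lemma \<open>emeasure_chains_above\<close>
  proves this by integration over the position of the lowest point; it treats the event that in
  addition all points lie above a given threshold, which makes the induction work without any
  order statistics. As \<open>q ^ k\<close> is summable, the infinite product converges to a limit strictly
  between \<open>0\<close> and \<open>1\<close> (\<open>chain_prob_LIMSEQ\<close>).

  In the double exponential case, the points are split by sign. Given the signs, the positive points
  and the reflected negative points are two independent exponential samples, and the graph is
  connected if both samples are connected and the gap around the origin is at most \<open>r\<close>. The points
  nearest to the origin on either side are within \<open>r / 2\<close> of it with probability \<open>1 - s ^ k\<close> for
  \<open>s = exp (- l * r / 2)\<close> and a sample of size \<open>k\<close>, and this tends to \<open>1\<close>. So the probability of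
  connectedness lies between two averages of products over the binomial number of positive
  points (\<open>prob_rgg_connected_double_exponential_bounds\<close>). Each factor tends to the limit of the
  one-sided case, and the binomial distribution puts vanishing mass on every bounded range of sizes,
  so both averages tend to the square of that limit (\<open>binomial_average_product\<close>).
\<close>

section \<open>Connectivity as the absence of large gaps\<close>

text \<open>
  The points enter only through the set of their positions. Adding a lowest point, reflecting, and
  splitting by sign then become \<open>insert\<close>, \<open>uminus `\<close> and \<open>\<union>\<close>, and points with the same position
  are identified.
\<close>

definition gap_free :: "real \<Rightarrow> real set \<Rightarrow> bool" where
  "gap_free r P \<longleftrightarrow> (\<forall>a\<in>P. \<forall>b\<in>P. a < b \<longrightarrow> (\<exists>c\<in>P. a < c \<and> c \<le> a + r))"

lemma gap_free_empty [simp]: "gap_free r {}"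
  and gap_free_singleton [simp]: "gap_free r {a}"
  by (auto simp: gap_free_def)

text \<open>
  This is the step of the recursion over the lowest point. The second conjunct negates that all points
  lie above a threshold, because the recursion computes the probabilities of events of that form.
\<close>

lemma gap_free_insert_minimum:
  assumes "P \<noteq> {}" and "\<forall>p\<in>P. m < p"
  shows "gap_free r (insert m P) \<longleftrightarrow> gap_free r P \<and> \<not> (\<forall>p\<in>P. m + r < p)"
proof
  assume G: "gap_free r (insert m P)"
  obtain p where "p \<in> P" "m < p" using assms by auto
  then have "\<exists>c\<in>P. c \<le> m + r"
    using G unfolding gap_free_def by blast
  moreover have "gap_free r P"
    unfolding gap_free_def
  proof (intro ballI impI)
    fix a b assume "a \<in> P" "b \<in> P" "a < b"
    then obtain c where "c \<in> insert m P" "a < c" "c \<le> a + r"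
      using G unfolding gap_free_def by blast
    moreover have "c \<noteq> m" using assms(2) \<open>a \<in> P\<close> \<open>a < c\<close> by auto
    ultimately show "\<exists>c\<in>P. a < c \<and> c \<le> a + r" by auto
  qed
  ultimately show "gap_free r P \<and> \<not> (\<forall>p\<in>P. m + r < p)" by force
next
  assume G: "gap_free r P \<and> \<not> (\<forall>p\<in>P. m + r < p)"
  then obtain p where p: "p \<in> P" "p \<le> m + r" by force
  show "gap_free r (insert m P)"
    unfolding gap_free_def
  proof (intro ballI impI)
    fix a b assume ab: "a \<in> insert m P" "b \<in> insert m P" "a < b"
    show "\<exists>c\<in>insert m P. a < c \<and> c \<le> a + r"
    proof (cases "a = m")
      case True
      then show ?thesis using p assms(2) by auto
    next
      case False
      then have "a \<in> P" "m < a" using ab assms(2) by auto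
      then have "b \<in> P" using ab by auto
      then show ?thesis using G \<open>a \<in> P\<close> \<open>a < b\<close> unfolding gap_free_def by blast
    qed
  qed
qed

text \<open>
  The definition looks from each position to the right; seen from the left, the gap below a position
  is bounded because it is also the gap above its left neighbour.
\<close>

lemma gap_free_uminusI:
  assumes fin: "finite P" and G: "gap_free r P"
  shows "gap_free r (uminus ` P)"
  unfolding gap_free_def
proof (intro ballI impI)
  fix a b assume "a \<in> uminus ` P" "b \<in> uminus ` P" "a < b"
  then have ab: "- a \<in> P" "- b \<in> P" "- b < - a" by auto
  (* The largest position c to the left of -a; by maximality, the next position reaches -a. *)
  define c where "c = Max {p \<in> P. p < - a}"
  have fin': "finite {p \<in> P. p < - a}" and ne: "{p \<in> P. p < - a} \<noteq> {}"
    using fin ab by auto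
  have c: "c \<in> P" "c < - a"
    using Max_in[OF fin' ne] by (auto simp: c_def)
  obtain d where d: "d \<in> P" "c < d" "d \<le> c + r"
    using G c ab(1) unfolding gap_free_def by blast
  have "- a \<le> d"
  proof (rule ccontr)
    assume "\<not> - a \<le> d"
    then have "d \<le> c" unfolding c_def using d(1) fin' by (intro Max_ge) auto
    with d(2) show False by simp
  qed
  then have "a < - c \<and> - c \<le> a + r" using c(2) d(3) by auto
  then show "\<exists>c\<in>uminus ` P. a < c \<and> c \<le> a + r" using c(1) by blast
qed

lemma gap_free_uminus: "finite P \<Longrightarrow> gap_free r (uminus ` P) \<longleftrightarrow> gap_free r P"
  using gap_free_uminusI[of P r] gap_free_uminusI[of "uminus ` P" r] by (auto simp: image_image)

text \<open>
  Only the right neighbour of a position matters, and that of a positive position is positive. The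
  corresponding fact for the negative positions follows by reflection.
\<close>

lemma gap_free_upper_part:
  assumes "gap_free r (P \<union> Q)" and "\<forall>p\<in>P. 0 < p" and "\<forall>q\<in>Q. q < (0::real)"
  shows "gap_free r P"
  unfolding gap_free_def
proof (intro ballI impI)
  fix a b assume "a \<in> P" "b \<in> P" "a < b"
  then obtain c where c: "c \<in> P \<union> Q" "a < c" "c \<le> a + r"
    using assms(1) unfolding gap_free_def by blast
  then have "c \<in> P" using assms(2,3) \<open>a \<in> P\<close> by force
  with c show "\<exists>c\<in>P. a < c \<and> c \<le> a + r" by blast
qed

lemma gap_free_parts:
  assumes "finite P" and "finite Q"
    and "gap_free r (P \<union> Q)" and "\<forall>p\<in>P. 0 < p" and "\<forall>q\<in>Q. q < (0::real)"
  shows "gap_free r P \<and> gap_free r Q"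
proof
  show "gap_free r P" using gap_free_upper_part assms(3-5) .
  have "gap_free r (uminus ` Q \<union> uminus ` P)"
    using gap_free_uminus[of "P \<union> Q" r] assms(1-3) by (simp add: image_Un Un_commute)
  then have "gap_free r (uminus ` Q)"
    by (rule gap_free_upper_part) (use assms(4,5) in auto)
  then show "gap_free r Q" using gap_free_uminus[of Q r] assms(2) by simp
qed

text \<open>
  A sufficient condition for the gap around the origin to be small that splits into one condition on
  each side. This makes the lower bound for the two-sided graph a product of probabilities.
\<close>

lemma gap_free_union:
  assumes P: "gap_free r P" "\<forall>p\<in>P. 0 < p" "p \<in> P" "p \<le> r / 2"
    and Q: "finite Q" "gap_free r Q" "\<forall>q\<in>Q. q < 0" "q \<in> Q" "- (r / 2) \<le> q"
  shows "gap_free r (P \<union> Q)"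
  unfolding gap_free_def
proof (intro ballI impI)
  fix a b assume ab: "a \<in> P \<union> Q" "b \<in> P \<union> Q" "a < b"
  show "\<exists>c\<in>P \<union> Q. a < c \<and> c \<le> a + r"
  proof (cases "a \<in> P")
    case True
    then have "b \<in> P" using ab P(2) Q(3) by force
    then show ?thesis using P(1) True ab(3) unfolding gap_free_def by blast
  next
    case False
    then have "a \<in> Q" using ab(1) by simp
    show ?thesis
    proof (cases "\<exists>b'\<in>Q. a < b'")
      case True
      then show ?thesis using Q(2) \<open>a \<in> Q\<close> unfolding gap_free_def by blast
    next
      case False
      then have "q \<le> a" using Q(4) by force
      then have "p \<le> a + r" using P(4) Q(5) by linarith
      moreover have "a < p" using Q(3) P(2,3) \<open>a \<in> Q\<close> by force
      ultimately show ?thesis using P(3) by blast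
    qed
  qed
qed

text \<open>
  A path cannot jump over a gap longer than \<open>r\<close>, and without such gaps one walks to the right from
  point to point. For \<open>n = 0\<close> the graph has no vertices and does not count as connected, although
  the empty set of positions has no gaps.
\<close>

lemma connected_geometric_graph_iff_gap_free:
  assumes "0 \<le> r"
  shows "Digraph_Component.connected (with_proj (geometric_graph n r x))
    \<longleftrightarrow> 0 < n \<and> gap_free r (x ` {1..n})"
proof -
  define I where "I = {1..n}"
  define R where "R = {(i, j). i \<in> I \<and> j \<in> I \<and> i \<noteq> j \<and> \<bar>x i - x j\<bar> \<le> r}"
  let ?G = "mk_symmetric (with_proj (geometric_graph n r x))"
  have G: "verts ?G = I" "arcs_ends ?G = R"
    by (auto simp: mk_symmetric_def geometric_graph_def I_def R_def arcs_ends_def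
        arc_to_ends_def image_def abs_minus_commute)
  have conn: "Digraph_Component.connected (with_proj (geometric_graph n r x))
      \<longleftrightarrow> 0 < n \<and> (\<forall>i\<in>I. \<forall>j\<in>I. (i, j) \<in> rtrancl_on I R)"
    unfolding Digraph_Component.connected_def strongly_connected_def reachable_def G
    by (simp add: I_def Suc_le_eq)
  have "gap_free r (x ` I)" if C: "\<forall>i\<in>I. \<forall>j\<in>I. (i, j) \<in> rtrancl_on I R"
    unfolding gap_free_def
  proof (intro ballI impI)
    fix a b assume "a \<in> x ` I" "b \<in> x ` I" "a < b"
    then obtain i j where ij: "i \<in> I" "j \<in> I" "x i = a" "x j = b" by auto
    show "\<exists>c\<in>x ` I. a < c \<and> c \<le> a + r"
    proof (rule ccontr)
      assume gap: "\<not> ?thesis"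
      (* No path leaves the set of points at or below a. *)
      have "(i, k) \<in> rtrancl_on I R \<Longrightarrow> x k \<le> a" for k
      proof (induction rule: rtrancl_on_induct)
        case (step y z)
        then have "z \<in> I" "x z \<le> x y + r" by (auto simp: R_def)
        then show ?case using gap step by force
      qed (use ij in auto)
      then show False using C ij \<open>a < b\<close> by force
    qed
  qed
  moreover have "\<forall>i\<in>I. \<forall>j\<in>I. (i, j) \<in> rtrancl_on I R" if GF: "gap_free r (x ` I)"
  proof (intro ballI)
    have up: "j \<in> I \<Longrightarrow> i \<in> I \<Longrightarrow> x i \<le> x j \<Longrightarrow> (i, j) \<in> rtrancl_on I R" for i j
    proof (induction "card {k \<in> I. x i < x k}" arbitrary: i rule: less_induct)
      case less
      show ?case
      proof (cases "x i = x j")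
        case True
        then show ?thesis using less.prems assms
          by (cases "i = j") (auto simp: R_def intro!: rtrancl_on_into_rtrancl_on[of i i])
      next
        case False
        then have lt: "x i < x j" using less.prems by simp
        show ?thesis
        proof (cases "x j \<le> x i + r")
          case True
          then have "(i, j) \<in> R" using less.prems lt by (auto simp: R_def)
          then show ?thesis using less.prems by (meson rtrancl_on_into_rtrancl_on rtrancl_on_refl)
        next
          case far: False
          obtain k where k: "k \<in> I" "x i < x k" "x k \<le> x i + r"
            using GF less.prems lt unfolding gap_free_def by blast
          have "{m \<in> I. x k < x m} \<subset> {m \<in> I. x i < x m}" using k by auto
          then have "card {m \<in> I. x k < x m} < card {m \<in> I. x i < x m}"
            by (intro psubset_card_mono) (auto simp: I_def)
          then have "(k, j) \<in> rtrancl_on I R"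
            using less.hyps less.prems k far by auto
          moreover have "(i, k) \<in> rtrancl_on I R"
            using k less.prems by (auto simp: R_def intro!: rtrancl_on_into_rtrancl_on[of i i])
          ultimately show ?thesis by (rule rtrancl_on_trans[rotated])
        qed
      qed
    qed
    have sym: "sym R" by (auto simp: sym_def R_def abs_minus_commute)
    fix i j assume "i \<in> I" "j \<in> I"
    then show "(i, j) \<in> rtrancl_on I R"
      using up[of i j] up[of j i] symD[OF rtrancl_on_sym[OF sym]]
      by (cases "x i \<le> x j") simp_all
  qed
  ultimately show ?thesis using conn I_def by blast
qed

section \<open>The law of the points\<close>

lemma gap_free_image:
  "gap_free r (x ` I) \<longleftrightarrow> (\<forall>i\<in>I. \<forall>j\<in>I. x i < x j \<longrightarrow> (\<exists>k\<in>I. x i < x k \<and> x k \<le> x i + r))"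
  by (auto simp: gap_free_def)

lemma borel_measurable_PiM_component:
  "i \<in> I \<Longrightarrow> sets M = sets (borel :: real measure) \<Longrightarrow> (\<lambda>x. x i) \<in> borel_measurable (\<Pi>\<^sub>M i\<in>I. M)"
  using measurable_component_singleton[of i I "\<lambda>_. M"] by (simp cong: measurable_cong_sets)

lemma pred_gap_free [measurable]:
  assumes "finite I" and M: "sets M = sets (borel :: real measure)"
  shows "Measurable.pred (\<Pi>\<^sub>M i\<in>I. M) (\<lambda>x. gap_free r (x ` I))"
proof -
  have "Measurable.pred (\<Pi>\<^sub>M i\<in>I. M) (\<lambda>x. x i < x j)"
    and "Measurable.pred (\<Pi>\<^sub>M i\<in>I. M) (\<lambda>x. x i \<le> x j + r)" if "i \<in> I" "j \<in> I" for i j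
    unfolding not_less[of "_ + r", symmetric]
    by (intro pred_intros_logic borel_measurable_pred_less borel_measurable_add
        borel_measurable_const borel_measurable_PiM_component that M)+
  then show ?thesis
    unfolding gap_free_image using assms(1) by (intro pred_intros_finite pred_intros_logic) auto
qed

lemma pred_all_greater [measurable]:
  assumes "finite I" and "J \<subseteq> I" and "sets M = sets (borel :: real measure)"
  shows "Measurable.pred (\<Pi>\<^sub>M i\<in>I. M) (\<lambda>x. \<forall>i\<in>J. t < x i)"
proof -
  have [measurable]: "(\<lambda>x. x i) \<in> borel_measurable (\<Pi>\<^sub>M i\<in>I. M)" if "i \<in> J" for i
    using measurable_component_singleton[of i I "\<lambda>_. M"] assms(2) that
    by (auto cong: measurable_cong_sets simp: assms(3))
  show ?thesis
    using finite_subset[OF assms(2,1)] by (intro pred_intros_finite) measurable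
qed

text \<open>
  Almost surely there are no ties, so the lowest point is unique. Integrating the \<open>i\<close>-th coordinate
  first reduces the claim to the absence of atoms.
\<close>

lemma AE_PiM_distinct:
  fixes M :: "real measure"
  assumes "prob_space M" and sets_M [measurable_cong]: "sets M = sets borel"
    and atomless: "\<And>a. AE y in M. y \<noteq> a"
    and I: "finite I" "i \<in> I" "j \<in> I" "i \<noteq> j"
  shows "AE x in (\<Pi>\<^sub>M i\<in>I. M). x i \<noteq> x j"
proof -
  interpret prob_space M by fact
  interpret product_sigma_finite "\<lambda>_. M" by standard
  define J where "J = I - {i}"
  have J: "finite J" "i \<notin> J" "j \<in> J" "I = insert i J" using I by (auto simp: J_def)
  let ?D = "{x \<in> space (\<Pi>\<^sub>M i\<in>I. M). x i = x j}"
  have [measurable]: "(\<lambda>x. x k) \<in> borel_measurable (\<Pi>\<^sub>M i\<in>I. M)" if "k \<in> I" for k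
    using measurable_component_singleton[OF that, of "\<lambda>_. M"]
    by (simp cong: measurable_cong_sets add: sets_M)
  have D [measurable]: "?D \<in> sets (\<Pi>\<^sub>M i\<in>I. M)" using I by measurable
  have "emeasure (\<Pi>\<^sub>M i\<in>I. M) ?D = (\<integral>\<^sup>+x. indicator ?D x \<partial>(\<Pi>\<^sub>M i\<in>I. M))"
    by simp
  also have "\<dots> = (\<integral>\<^sup>+x. (\<integral>\<^sup>+y. indicator ?D (x(i := y)) \<partial>M) \<partial>(\<Pi>\<^sub>M i\<in>J. M))"
    using J D unfolding J(4) by (intro product_nn_integral_insert) auto
  also have "\<dots> = (\<integral>\<^sup>+x. 0 \<partial>(\<Pi>\<^sub>M i\<in>J. M))"
  proof (intro nn_integral_cong)
    fix x
    have "AE y in M. indicator ?D (x(i := y)) = (0::ennreal)"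
      using atomless[of "x j"] I(4) by (auto elim!: eventually_mono simp: indicator_def)
    then show "(\<integral>\<^sup>+y. indicator ?D (x(i := y)) \<partial>M) = 0"
      by (subst nn_integral_cong_AE[where v = "\<lambda>_. 0"]) auto
  qed
  finally show ?thesis
    using D by (intro AE_I[where N = ?D]) auto
qed

lemma nn_integral_exponential_tail:
  assumes "0 < a" and "0 \<le> C"
  shows "(\<integral>\<^sup>+y. ennreal (C * exp (- a * y)) * indicator {t<..} y \<partial>lborel) = ennreal (C / a * exp (- a * t))"
proof -
  have "(\<integral>\<^sup>+y. ennreal (C * exp (- a * y)) * indicator {t<..} y \<partial>lborel)
      = (\<integral>\<^sup>+y. ennreal (C * exp (- a * y)) * indicator {t..} y \<partial>lborel)"
    using AE_lborel_singleton[of t]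
    by (intro nn_integral_cong_AE) (auto elim!: eventually_mono simp: indicator_def)
  also have "\<dots> = ennreal (0 - (- (C / a) * exp (- a * t)))"
  proof (rule nn_integral_FTC_atLeast)
    have "LIM y at_top. - a * y :> at_bot"
      using assms(1) by (subst filterlim_uminus_at_bot) (auto intro!: filterlim_tendsto_pos_mult_at_top filterlim_ident)
    then have "((\<lambda>y. exp (- a * y)) \<longlongrightarrow> 0) at_top"
      by (rule filterlim_compose[OF exp_at_bot])
    then show "((\<lambda>y. - (C / a) * exp (- a * y)) \<longlongrightarrow> 0) at_top"
      by (rule tendsto_mult_right_zero)
  qed (use assms in \<open>auto intro!: derivative_eq_intros\<close>)
  finally show ?thesis by simp
qed

section \<open>The recursion over the lowest point\<close>

text \<open>
  The \<open>q\<close>-Pochhammer symbol \<open>(q; q)\<close> of order \<open>n - 1\<close>. With \<open>q = exp (- l * r)\<close>, the factor with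
  index \<open>k\<close> is the probability that the gap which has exactly \<open>k\<close> points above it, an exponential
  variable of rate \<open>k * l\<close>, is at most \<open>r\<close>. The value at \<open>0\<close> is \<open>1\<close>, which is what the empty
  configuration requires.
\<close>

definition chain_prob :: "real \<Rightarrow> nat \<Rightarrow> real" where
  "chain_prob q n = (\<Prod>k=1..<n. 1 - q ^ k)"

lemma chain_prob_0 [simp]: "chain_prob q 0 = 1"
  and chain_prob_1 [simp]: "chain_prob q (Suc 0) = 1"
  by (simp_all add: chain_prob_def)

lemma chain_prob_Suc: "0 < n \<Longrightarrow> chain_prob q (Suc n) = chain_prob q n * (1 - q ^ n)"
  by (simp add: chain_prob_def prod.atLeastLessThan_Suc)

lemma chain_prob_nonneg: "0 \<le> q \<Longrightarrow> q \<le> 1 \<Longrightarrow> 0 \<le> chain_prob q n"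
  unfolding chain_prob_def by (intro prod_nonneg) (auto simp: power_le_one)

text \<open>
  A law whose restriction to the positive half-line is \<open>c\<close> times the exponential law: \<open>c = 1\<close> gives
  the exponential and \<open>c = 1 / 2\<close> the double exponential law. Both graphs are thus covered by one
  recursion, which only ever looks at positive points.
\<close>

locale exponential_right_tail =
  fixes f :: "real \<Rightarrow> real" and c l :: real
  assumes f_measurable [measurable]: "f \<in> borel_measurable borel"
    and l_pos: "0 < l"
    and c_nonneg: "0 \<le> c"
    and tail: "0 < y \<Longrightarrow> f y = c * (l * exp (- l * y))"
    and prob: "prob_space (density lborel (\<lambda>t. ennreal (f t)))"
begin

definition M :: "real measure" where
  "M = density lborel (\<lambda>t. ennreal (f t))"

lemma sets_M [simp, measurable_cong]: "sets M = sets borel"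
  and space_M [simp]: "space M = UNIV"
  by (simp_all add: M_def)

sublocale prob_space M
  using prob by (simp add: M_def)

sublocale P: product_prob_space "\<lambda>_. M" I for I :: "nat set"
  by standard

lemma AE_M_neq: "AE y in M. y \<noteq> a"
  using AE_lborel_singleton[of a] unfolding M_def by (subst AE_density) (auto elim: eventually_mono)

abbreviation chains_above :: "real \<Rightarrow> nat set \<Rightarrow> real \<Rightarrow> (nat \<Rightarrow> real) set" where
  "chains_above r I t \<equiv> {x \<in> space (\<Pi>\<^sub>M i\<in>I. M). (\<forall>i\<in>I. t < x i) \<and> gap_free r (x ` I)}"

lemma sets_chains_above [measurable]: "finite I \<Longrightarrow> chains_above r I t \<in> sets (\<Pi>\<^sub>M i\<in>I. M)"
  by measurable


lemma emeasure_PiM_ne_infinity: "emeasure (\<Pi>\<^sub>M i\<in>I. M) A \<noteq> \<infinity>"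
  using finite_measure.emeasure_finite[OF prob_space.finite_measure[OF prob_space_PiM]]
    prob_space_axioms by simp

lemma nn_integral_M_tail:
  assumes "0 \<le> t" and "0 \<le> K"
  shows "(\<integral>\<^sup>+y. ennreal (K * exp (- l * y) ^ n) * indicator {t<..} y \<partial>M)
    = ennreal (c * K / Suc n * exp (- l * t) ^ Suc n)"
proof -
  have "(\<integral>\<^sup>+y. ennreal (K * exp (- l * y) ^ n) * indicator {t<..} y \<partial>M)
      = (\<integral>\<^sup>+y. ennreal (f y) * (ennreal (K * exp (- l * y) ^ n) * indicator {t<..} y) \<partial>lborel)"
    unfolding M_def by (rule nn_integral_density) measurable
  also have "\<dots> = (\<integral>\<^sup>+y. ennreal (c * l * K * exp (- (l * Suc n) * y)) * indicator {t<..} y \<partial>lborel)"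
  proof (intro nn_integral_cong)
    fix y
    have "exp (- l * y) * exp (- l * y) ^ n = exp (- (l * Suc n) * y)"
      unfolding exp_of_nat_mult[symmetric] mult_exp_exp by (simp add: algebra_simps)
    then have "f y * (K * exp (- l * y) ^ n) = c * l * K * exp (- (l * Suc n) * y)" if "t < y"
      using tail[of y] assms that by (metis (no_types, lifting) le_less_trans mult.assoc mult.left_commute)
    moreover have "0 \<le> f y" if "t < y"
      using tail[of y] assms that c_nonneg l_pos by simp
    ultimately show "ennreal (f y) * (ennreal (K * exp (- l * y) ^ n) * indicator {t<..} y)
        = ennreal (c * l * K * exp (- (l * Suc n) * y)) * indicator {t<..} y"
      by (cases "t < y") (simp_all only: indicator_simps greaterThan_iff mult_1_right mult_zero_right
          ennreal_mult'[symmetric] simp_thms)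
  qed
  also have "\<dots> = ennreal (c * l * K / (l * Suc n) * exp (- (l * Suc n) * t))"
    using l_pos c_nonneg assms(2) by (intro nn_integral_exponential_tail) auto
  also have "c * l * K / (l * Suc n) * exp (- (l * Suc n) * t) = c * K / Suc n * exp (- l * t) ^ Suc n"
    using l_pos unfolding exp_of_nat_mult[symmetric] by (simp add: field_simps del: of_nat_Suc)
  finally show ?thesis .
qed

text \<open>
  Fix the position \<open>y\<close> of the lowest point. The other points must form a chain above \<open>y\<close>, but not a
  chain above \<open>y + r\<close>; by the induction hypothesis the difference of these two probabilities is the
  first one times \<open>1 - q ^ n\<close>, for every \<open>y\<close>. This is the lack of memory of the exponential law.
  It remains to integrate over \<open>y\<close>.
\<close>

lemma emeasure_chains_with_minimum:
  assumes r: "0 \<le> r" and q: "q = exp (- l * r)"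
    and J: "finite J" "i \<notin> J" and t: "0 \<le> t"
    and IH: "\<And>s. 0 \<le> s \<Longrightarrow> emeasure (\<Pi>\<^sub>M i\<in>J. M) (chains_above r J s)
      = ennreal (c ^ card J * chain_prob q (card J) * exp (- l * s) ^ card J)"
  shows "emeasure (\<Pi>\<^sub>M i\<in>insert i J. M) {x \<in> space (\<Pi>\<^sub>M i\<in>insert i J. M).
      t < x i \<and> (\<forall>j\<in>J. x i < x j) \<and> gap_free r (x ` insert i J)}
    = ennreal (c ^ Suc (card J) * chain_prob q (Suc (card J)) / Suc (card J) * exp (- l * t) ^ Suc (card J))"
    (is "emeasure ?PI ?E = _")
proof -
  let ?PJ = "\<Pi>\<^sub>M i\<in>J. M"
  define n where "n = card J"
  define K where "K = c ^ n * chain_prob q (Suc n)"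
  have q01: "0 \<le> q" "q \<le> 1" using r l_pos by (auto simp: q)
  have K0: "0 \<le> K" using c_nonneg chain_prob_nonneg[OF q01] by (simp add: K_def)
  have comp: "(\<lambda>x. x j) \<in> borel_measurable ?PI" if "j \<in> insert i J" for j
    using measurable_component_singleton[OF that, of "\<lambda>_. M"] by (simp cong: measurable_cong_sets)
  have E: "?E \<in> sets ?PI"
  proof -
    have [measurable]: "(\<lambda>x. x i) \<in> borel_measurable ?PI" by (rule comp) simp
    have [measurable]: "(\<lambda>x. x j) \<in> borel_measurable ?PI" if "j \<in> J" for j by (rule comp) (use that in simp)
    have [measurable]: "Measurable.pred ?PI (\<lambda>x. gap_free r (x ` insert i J))"
      by (rule pred_gap_free) (use J in auto)
    have [measurable]: "Measurable.pred ?PI (\<lambda>x. \<forall>j\<in>J. x i < x j)"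
      using J(1) by (intro pred_intros_finite) measurable
    show ?thesis by measurable
  qed
  have inner: "(\<integral>\<^sup>+x. indicator ?E (x(i := y)) \<partial>?PJ)
      = ennreal (K * exp (- l * y) ^ n) * indicator {t<..} y" for y
  proof (cases "t < y")
    case False
    then have "(\<integral>\<^sup>+x. indicator ?E (x(i := y)) \<partial>?PJ) = (\<integral>\<^sup>+x. 0 \<partial>?PJ)"
      by (intro nn_integral_cong) (auto simp: indicator_def)
    then show ?thesis using False by simp
  next
    case True
    then have y: "0 \<le> y" "0 \<le> y + r" using t r by auto
    have upd: "x(i := y) \<in> ?E \<longleftrightarrow> (\<forall>j\<in>J. y < x j) \<and> gap_free r (insert y (x ` J))"
      if "x \<in> space ?PJ" for x
    proof -
      have "x(i := y) \<in> space ?PI"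
        using that by (auto simp: space_PiM PiE_def extensional_def)
      moreover have "(x(i := y)) ` insert i J = insert y (x ` J)"
        using J(2) by auto
      ultimately show ?thesis using True J(2) by auto
    qed
    have diff: "{x \<in> space ?PJ. (\<forall>j\<in>J. y < x j) \<and> gap_free r (insert y (x ` J))}
        = chains_above r J y - chains_above r J (y + r)" if "J \<noteq> {}"
    proof (intro set_eqI)
      fix x :: "nat \<Rightarrow> real"
      have "gap_free r (insert y (x ` J)) \<longleftrightarrow> gap_free r (x ` J) \<and> \<not> (\<forall>j\<in>J. y + r < x j)"
        if "\<forall>j\<in>J. y < x j"
        using gap_free_insert_minimum[of "x ` J" y r] that \<open>J \<noteq> {}\<close> by simp
      then show "x \<in> {x \<in> space ?PJ. (\<forall>j\<in>J. y < x j) \<and> gap_free r (insert y (x ` J))}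
          \<longleftrightarrow> x \<in> chains_above r J y - chains_above r J (y + r)"
        by blast
    qed
    have "emeasure ?PJ {x \<in> space ?PJ. (\<forall>j\<in>J. y < x j) \<and> gap_free r (insert y (x ` J))}
        = ennreal (K * exp (- l * y) ^ n)"
      (* A single point has no gap above it, and the product has no factor with index 0. *)
    proof (cases "J = {}")
      case True
      then show ?thesis by (simp add: K_def n_def P.emeasure_space_1)
    next
      case False
      then have n: "0 < n" using J by (auto simp: n_def card_gt_0_iff)
      have "emeasure ?PJ {x \<in> space ?PJ. (\<forall>j\<in>J. y < x j) \<and> gap_free r (insert y (x ` J))} = emeasure ?PJ (chains_above r J y) - emeasure ?PJ (chains_above r J (y + r))"
        unfolding diff[OF False]
        using J(1) r by (intro emeasure_Diff emeasure_PiM_ne_infinity sets_chains_above) force+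
      also have "\<dots> = ennreal (c ^ n * chain_prob q n * exp (- l * y) ^ n
          - c ^ n * chain_prob q n * exp (- l * (y + r)) ^ n)"
        unfolding IH[OF y(1)] IH[OF y(2)] n_def
        by (intro ennreal_minus mult_nonneg_nonneg zero_le_power c_nonneg chain_prob_nonneg q01 exp_ge_zero)
      also have "exp (- l * (y + r)) = exp (- l * y) * q"
        by (simp add: q mult_exp_exp algebra_simps)
      also have "c ^ n * chain_prob q n * exp (- l * y) ^ n - c ^ n * chain_prob q n * (exp (- l * y) * q) ^ n
          = K * exp (- l * y) ^ n"
        using n by (simp add: K_def chain_prob_Suc power_mult_distrib algebra_simps)
      finally show ?thesis .
    qed
    moreover have "(\<integral>\<^sup>+x. indicator ?E (x(i := y)) \<partial>?PJ) = (\<integral>\<^sup>+x.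
        indicator {x \<in> space ?PJ. (\<forall>j\<in>J. y < x j) \<and> gap_free r (insert y (x ` J))} x \<partial>?PJ)"
      by (intro nn_integral_cong) (simp only: indicator_def upd, simp)
    moreover have "{x \<in> space ?PJ. (\<forall>j\<in>J. y < x j) \<and> gap_free r (insert y (x ` J))} \<in> sets ?PJ"
    proof (cases "J = {}")
      case False
      then show ?thesis using J(1) by (subst diff) auto
    qed simp
    ultimately show ?thesis using True by simp
  qed
  have "emeasure ?PI ?E = (\<integral>\<^sup>+x. indicator ?E x \<partial>?PI)"
    using E by simp
  also have "\<dots> = (\<integral>\<^sup>+y. (\<integral>\<^sup>+x. indicator ?E (x(i := y)) \<partial>?PJ) \<partial>M)"
    using J E by (intro P.product_nn_integral_insert_rev) auto
  also have "\<dots> = ennreal (c * K / Suc n * exp (- l * t) ^ Suc n)"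
    unfolding inner by (rule nn_integral_M_tail) fact+
  also have "c * K / Suc n * exp (- l * t) ^ Suc n
      = c ^ Suc n * chain_prob q (Suc n) / Suc n * exp (- l * t) ^ Suc n"
    by (simp add: K_def)
  finally show ?thesis unfolding n_def .
qed

text \<open>
  Every threshold \<open>t\<close> is needed in the induction, since the lowest point becomes the threshold for the
  remaining ones. Almost surely exactly one of the \<open>Suc n\<close> points is the lowest; by symmetry all of
  them contribute equally, which cancels the denominator \<open>Suc n\<close> coming from the integration.
\<close>

lemma emeasure_chains_above:
  assumes r: "0 \<le> r" and q: "q = exp (- l * r)" and "finite I" and "0 \<le> t"
  shows "emeasure (\<Pi>\<^sub>M i\<in>I. M) (chains_above r I t)
    = ennreal (c ^ card I * chain_prob q (card I) * exp (- l * t) ^ card I)"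
  using assms(3,4)
proof (induction "card I" arbitrary: I t)
  case 0
  then have "I = {}" by simp
  then show ?case by (simp add: P.emeasure_space_1)
next
  case (Suc n)
  let ?PI = "\<Pi>\<^sub>M i\<in>I. M"
  define E where "E i = {x \<in> space ?PI. t < x i \<and> (\<forall>j\<in>I - {i}. x i < x j) \<and> gap_free r (x ` I)}" for i
  have E: "emeasure ?PI (E i) = ennreal (c ^ Suc n * chain_prob q (Suc n) / Suc n * exp (- l * t) ^ Suc n)"
    and sets_E: "E i \<in> sets ?PI" if i: "i \<in> I" for i
  proof -
    have n: "n = card (I - {i})" using Suc i by simp
    have I: "I = insert i (I - {i})" using i by auto
    show "emeasure ?PI (E i) = ennreal (c ^ Suc n * chain_prob q (Suc n) / Suc n * exp (- l * t) ^ Suc n)"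
      using emeasure_chains_with_minimum[OF r q, of "I - {i}" i t]
        Suc.hyps(1)[OF n] Suc.prems unfolding E_def n[symmetric] I[symmetric] by auto
    have [measurable]: "(\<lambda>x. x j) \<in> borel_measurable ?PI" if "j \<in> I" for j
      using measurable_component_singleton[OF that, of "\<lambda>_. M"] by (simp cong: measurable_cong_sets)
    have [measurable]: "Measurable.pred ?PI (\<lambda>x. \<forall>j\<in>I - {i}. x i < x j)"
      using Suc.prems(1) i by (intro pred_intros_finite) measurable
    show "E i \<in> sets ?PI"
      unfolding E_def using i Suc.prems(1) by measurable
  qed
  have "AE x in ?PI. \<forall>i\<in>I. \<forall>j\<in>I. i \<noteq> j \<longrightarrow> x i \<noteq> x j"
    using Suc.prems(1) AE_PiM_distinct[OF prob_space_axioms sets_M AE_M_neq]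
    by (intro AE_finite_allI) auto
  then have "AE x in ?PI. x \<in> chains_above r I t \<longleftrightarrow> x \<in> (\<Union>i\<in>I. E i)"
    using AE_space
  proof eventually_elim
    case (elim x)
    have "\<exists>i\<in>I. \<forall>j\<in>I - {i}. x i < x j"
    proof -
      have ne: "I \<noteq> {}" using Suc.hyps(2) by auto
      then have "Min (x ` I) \<in> x ` I" using Suc.prems(1) by (intro Min_in) auto
      then obtain i where i: "i \<in> I" "x i = Min (x ` I)" by auto
      have "x i < x j" if "j \<in> I - {i}" for j
      proof -
        have "x i \<le> x j" using that Suc.prems(1) by (simp add: i(2))
        then show ?thesis using elim(1) i(1) that by force
      qed
      then show ?thesis using i(1) by auto
    qed
    then obtain i where i: "i \<in> I" "\<forall>j\<in>I - {i}. x i < x j" ..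
    show ?case
    proof
      assume "x \<in> chains_above r I t"
      then show "x \<in> (\<Union>i\<in>I. E i)" using i by (auto simp: E_def)
    next
      assume "x \<in> (\<Union>i\<in>I. E i)"
      then obtain k where "k \<in> I" "x \<in> E k" by auto
      then show "x \<in> chains_above r I t"
        unfolding E_def by (auto dest: less_trans)
    qed
  qed
  then have "emeasure ?PI (chains_above r I t) = emeasure ?PI (\<Union>i\<in>I. E i)"
    using Suc.prems(1) sets_E by (intro emeasure_eq_AE) auto
  also have "\<dots> = (\<Sum>i\<in>I. emeasure ?PI (E i))"
    using Suc.prems(1) sets_E
    by (intro sum_emeasure[symmetric]) (auto simp: disjoint_family_on_def E_def dest: less_asym)
  also have "\<dots> = (\<Sum>i\<in>I. ennreal (c ^ Suc n * chain_prob q (Suc n) / Suc n * exp (- l * t) ^ Suc n))"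
    using E by (intro sum.cong) auto
  also have "\<dots> = ennreal (real (Suc n) * (c ^ Suc n * chain_prob q (Suc n) / Suc n * exp (- l * t) ^ Suc n))"
    by (simp add: Suc.hyps(2)[symmetric] ennreal_mult'[symmetric] ennreal_of_nat_eq_real_of_nat del: of_nat_Suc)
  also have "real (Suc n) * (c ^ Suc n * chain_prob q (Suc n) / Suc n * exp (- l * t) ^ Suc n)
      = c ^ Suc n * chain_prob q (Suc n) * exp (- l * t) ^ Suc n"
    by (simp del: of_nat_Suc)
  finally show ?case unfolding Suc.hyps(2) .
qed

lemma measure_chains_above:
  assumes "0 \<le> r" and "q = exp (- l * r)" and "finite I" and "0 \<le> t"
  shows "measure (\<Pi>\<^sub>M i\<in>I. M) (chains_above r I t)
    = c ^ card I * chain_prob q (card I) * exp (- l * t) ^ card I"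
proof -
  have "0 \<le> chain_prob q (card I)"
    using assms l_pos by (intro chain_prob_nonneg) auto
  then show ?thesis
    unfolding measure_def emeasure_chains_above[OF assms]
    using c_nonneg by (intro enn2real_ennreal) simp
qed

lemma prob_rgg_connected_eq_measure:
  assumes "0 \<le> r" and "0 < n"
  shows "prob_rgg_connected f n r
    = measure (\<Pi>\<^sub>M i\<in>{1..n}. M) {x \<in> space (\<Pi>\<^sub>M i\<in>{1..n}. M). gap_free r (x ` {1..n})}"
  using assms by (simp add: prob_rgg_connected_def points_measure_def M_def
      connected_geometric_graph_iff_gap_free)

end

section \<open>Limits\<close>

text \<open>
  The infinite product converges to a nonzero value because \<open>q ^ k\<close> is summable and no factor
  vanishes; the limit is below \<open>1\<close> because its first factor is \<open>1 - q\<close> and no factor exceeds \<open>1\<close>.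
\<close>

lemma chain_prob_LIMSEQ:
  assumes q: "0 < q" "q < 1"
  obtains Pc where "0 < Pc" "Pc < 1" "chain_prob q \<longlonglongrightarrow> Pc"
proof -
  define g where "g k = 1 + - (q ^ Suc k)" for k
  have q_pow: "q ^ Suc k < 1" for k
    using q by (intro power_Suc_less_one) auto
  have "summable (\<lambda>k. \<bar>- (q ^ Suc k)\<bar>)"
    using q by (simp add: abs_mult power_abs summable_mult summable_geometric)
  then have conv: "convergent_prod g"
    unfolding g_def using q_pow by (intro summable_imp_convergent_prod_real) (auto simp: less_le)
  have partial: "(\<Prod>k\<le>n. g k) = chain_prob q (n + 2)" for n
    by (induction n) (simp_all add: g_def chain_prob_Suc)
  have "(\<lambda>n. chain_prob q (n + 2)) \<longlonglongrightarrow> prodinf g"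
    using convergent_prod_LIMSEQ[OF conv] unfolding partial .
  then have lim: "chain_prob q \<longlonglongrightarrow> prodinf g"
    by (rule LIMSEQ_offset)
  have le: "chain_prob q (n + 2) \<le> 1 - q" for n
  proof (induction n)
    case (Suc n)
    have "chain_prob q (n + 2) * (1 - q ^ (n + 2)) \<le> chain_prob q (n + 2) * 1"
      using q by (intro mult_left_mono chain_prob_nonneg) auto
    then show ?case using Suc chain_prob_Suc[of "n + 2" q] by simp
  qed (simp add: chain_prob_Suc numeral_2_eq_2)
  show thesis
  proof
    show "0 < prodinf g"
      using conv q_pow by (intro less_0_prodinf) (auto simp: g_def)
    have "prodinf g \<le> 1 - q"
      using le by (intro LIMSEQ_le_const2[OF LIMSEQ_ignore_initial_segment[OF lim, of 2]]) auto
    then show "prodinf g < 1" using q by simp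
    show "chain_prob q \<longlonglongrightarrow> prodinf g" by fact
  qed
qed

lemma tendsto_binomial_weight: "(\<lambda>n. real (n choose k) / 2 ^ n) \<longlonglongrightarrow> 0"
proof (rule tendsto_sandwich[where f = "\<lambda>_. 0" and h = "\<lambda>n. real n ^ k / 2 ^ n"])
  show "\<forall>\<^sub>F n in sequentially. real (n choose k) / 2 ^ n \<le> real n ^ k / 2 ^ n"
    using eventually_ge_at_top[of k]
    by eventually_elim (auto intro!: divide_right_mono simp flip: of_nat_power intro: binomial_le_pow)
  show "(\<lambda>n. real n ^ k / 2 ^ n) \<longlonglongrightarrow> 0"
    by real_asymp
qed auto

text \<open>
  A Toeplitz argument: the binomial weights sum to \<open>1\<close>, and each single weight tends to \<open>0\<close>, so that
  finitely many indices carry a vanishing part of the mass.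
\<close>

lemma binomial_average_null:
  fixes d :: "nat \<Rightarrow> real"
  assumes d: "d \<longlonglongrightarrow> 0"
  shows "(\<lambda>n. \<Sum>k\<le>n. real (n choose k) / 2 ^ n * d k) \<longlonglongrightarrow> 0"
proof (rule LIMSEQ_I)
  fix e :: real assume e: "0 < e"
  define w where "w n k = real (n choose k) / 2 ^ n" for n k
  have w: "0 \<le> w n k" for n k by (simp add: w_def)
  have w_sum: "(\<Sum>k\<le>n. w n k) = 1" for n
    unfolding w_def sum_divide_distrib[symmetric]
    using choose_row_sum[of n] by (simp flip: of_nat_sum)
  obtain K where K: "\<And>k. K \<le> k \<Longrightarrow> \<bar>d k\<bar> < e / 2"
    using LIMSEQ_D[OF d, of "e / 2"] e by auto
  have "(\<lambda>n. \<Sum>k<K. w n k * \<bar>d k\<bar>) \<longlonglongrightarrow> (\<Sum>k<K. 0 * \<bar>d k\<bar>)"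
    unfolding w_def by (intro tendsto_sum tendsto_mult tendsto_binomial_weight tendsto_const)
  then have "\<forall>\<^sub>F n in sequentially. (\<Sum>k<K. w n k * \<bar>d k\<bar>) < e / 2"
    using e by (intro order_tendstoD(2)) auto
  then obtain N where N: "\<And>n. N \<le> n \<Longrightarrow> (\<Sum>k<K. w n k * \<bar>d k\<bar>) < e / 2"
    by (auto simp: eventually_sequentially)
  have "\<bar>\<Sum>k\<le>n. w n k * d k\<bar> < e" if n: "N \<le> n" for n
  proof -
    have "\<bar>\<Sum>k\<le>n. w n k * d k\<bar> \<le> (\<Sum>k\<le>n. w n k * \<bar>d k\<bar>)"
      using sum_abs[of "\<lambda>k. w n k * d k" "{..n}"] w by (simp add: abs_mult)
    also have "\<dots> \<le> (\<Sum>k\<le>n. (if k < K then w n k * \<bar>d k\<bar> else 0) + w n k * (e / 2))"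
      (* The term e / 2 is added for every k, so that the weights sum up to 1. *)
    proof (intro sum_mono)
      fix k
      have "w n k * \<bar>d k\<bar> \<le> w n k * (e / 2)" if "\<not> k < K"
        using K[of k] that by (intro mult_left_mono w) auto
      then show "w n k * \<bar>d k\<bar> \<le> (if k < K then w n k * \<bar>d k\<bar> else 0) + w n k * (e / 2)"
        using w[of n k] e by auto
    qed
    also have "\<dots> = (\<Sum>k\<in>{k\<in>{..n}. k < K}. w n k * \<bar>d k\<bar>) + e / 2"
      by (subst sum.inter_filter) (simp_all add: sum.distrib sum_distrib_right[symmetric] w_sum
          del: times_divide_eq_right)
    also have "\<dots> \<le> (\<Sum>k<K. w n k * \<bar>d k\<bar>) + e / 2"
      using w by (intro add_right_mono sum_mono2) auto
    also have "\<dots> < e" using N[OF n] by simp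
    finally show ?thesis .
  qed
  then show "\<exists>no. \<forall>n\<ge>no. norm ((\<Sum>k\<le>n. real (n choose k) / 2 ^ n * d k) - 0) < e"
    unfolding w_def by auto
qed

text \<open>
  Both \<open>k\<close> and \<open>n - k\<close> are large for most of the mass. The difference from \<open>A * B\<close> is bounded by two
  averages of null sequences, one of which is reversed by the symmetry of the binomial
  coefficients.
\<close>

lemma binomial_average_product:
  fixes a b :: "nat \<Rightarrow> real"
  assumes a: "a \<longlonglongrightarrow> A" and b: "b \<longlonglongrightarrow> B"
  shows "(\<lambda>n. \<Sum>k\<le>n. real (n choose k) / 2 ^ n * (a k * b (n - k))) \<longlonglongrightarrow> A * B"
proof -
  define w where "w n k = real (n choose k) / 2 ^ n" for n k
  have w: "0 \<le> w n k" for n k by (simp add: w_def)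
  have w_sum: "(\<Sum>k\<le>n. w n k) = 1" for n
    unfolding w_def sum_divide_distrib[symmetric]
    using choose_row_sum[of n] by (simp flip: of_nat_sum)
  have "Bseq a" using a by (intro convergent_imp_Bseq) (auto simp: convergent_def)
  then obtain C where "\<forall>k. norm (a k) \<le> C" by (auto elim: BseqE)
  then have C: "\<bar>a k\<bar> \<le> C" for k by simp
  let ?S = "\<lambda>n. \<Sum>k\<le>n. w n k * (a k * b (n - k))"
  let ?U = "\<lambda>n. \<bar>B\<bar> * (\<Sum>k\<le>n. w n k * \<bar>a k - A\<bar>) + C * (\<Sum>k\<le>n. w n k * \<bar>b k - B\<bar>)"
  have bound: "norm (?S n - A * B) \<le> ?U n" for n
  proof -
    have "?S n - A * B = (\<Sum>k\<le>n. w n k * (a k * b (n - k) - A * B))"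
      using w_sum[of n] by (simp add: right_diff_distrib sum_subtractf sum_distrib_right[symmetric])
    also have "\<bar>\<dots>\<bar> \<le> (\<Sum>k\<le>n. w n k * \<bar>a k * b (n - k) - A * B\<bar>)"
      using sum_abs[of "\<lambda>k. w n k * (a k * b (n - k) - A * B)" "{..n}"] w by (simp add: abs_mult)
    also have "\<dots> \<le> (\<Sum>k\<le>n. w n k * (\<bar>B\<bar> * \<bar>a k - A\<bar> + C * \<bar>b (n - k) - B\<bar>))"
    proof (intro sum_mono mult_left_mono w)
      fix k
      have "a k * b (n - k) - A * B = B * (a k - A) + a k * (b (n - k) - B)"
        by (simp add: algebra_simps)
      also have "\<bar>\<dots>\<bar> \<le> \<bar>B\<bar> * \<bar>a k - A\<bar> + \<bar>a k\<bar> * \<bar>b (n - k) - B\<bar>"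
        by (metis abs_mult abs_triangle_ineq)
      also have "\<dots> \<le> \<bar>B\<bar> * \<bar>a k - A\<bar> + C * \<bar>b (n - k) - B\<bar>"
        by (intro add_left_mono mult_right_mono C) simp
      finally show "\<bar>a k * b (n - k) - A * B\<bar> \<le> \<bar>B\<bar> * \<bar>a k - A\<bar> + C * \<bar>b (n - k) - B\<bar>" .
    qed
    also have "\<dots> = \<bar>B\<bar> * (\<Sum>k\<le>n. w n k * \<bar>a k - A\<bar>) + C * (\<Sum>k\<le>n. w n k * \<bar>b (n - k) - B\<bar>)"
      by (simp add: distrib_left sum.distrib sum_distrib_left mult.left_commute)
    also have "(\<Sum>k\<le>n. w n k * \<bar>b (n - k) - B\<bar>) = (\<Sum>k\<le>n. w n k * \<bar>b k - B\<bar>)"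
      by (rule sum.reindex_bij_witness[where i = "\<lambda>k. n - k" and j = "\<lambda>k. n - k"])
        (auto simp: w_def binomial_symmetric[symmetric])
    finally show ?thesis by simp
  qed
  have "?U \<longlonglongrightarrow> \<bar>B\<bar> * 0 + C * 0"
    unfolding w_def using a b
    by (intro tendsto_intros binomial_average_null) (auto intro: tendsto_rabs_zero LIM_zero)
  then have "?U \<longlonglongrightarrow> 0" unfolding mult_zero_right add_0 .
  then have "(\<lambda>n. ?S n - A * B) \<longlonglongrightarrow> 0"
    by (rule Lim_null_comparison[OF always_eventually[OF allI[OF bound]]])
  then show ?thesis unfolding w_def by (rule LIM_zero_cancel)
qed

lemma sum_Pow_card:
  fixes g :: "nat \<Rightarrow> real"
  assumes "finite I"
  shows "(\<Sum>S\<in>Pow I. g (card S)) = (\<Sum>k\<le>card I. real (card I choose k) * g k)"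
proof -
  have "(\<Sum>S\<in>Pow I. g (card S)) = (\<Sum>k\<le>card I. \<Sum>S\<in>{S\<in>Pow I. card S = k}. g (card S))"
    using assms by (intro sum.group[symmetric]) (auto intro: card_mono)
  also have "\<dots> = (\<Sum>k\<le>card I. real (card {S\<in>Pow I. card S = k}) * g k)"
    by (intro sum.cong) auto
  also have "\<dots> = (\<Sum>k\<le>card I. real (card I choose k) * g k)"
    using assms by (simp add: n_subsets)
  finally show ?thesis .
qed

section \<open>Splitting the points by sign\<close>

text \<open>
  Independence of the points with index in \<open>S\<close> from those with index in \<open>T\<close>.
\<close>

lemma measure_PiM_rectangle:
  fixes M :: "'a measure" and S T :: "nat set"
  assumes "prob_space M" and ST: "S \<inter> T = {}" "finite S" "finite T"
    and A: "A \<in> sets (\<Pi>\<^sub>M i\<in>S. M)" and B: "B \<in> sets (\<Pi>\<^sub>M i\<in>T. M)"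
  shows "{x \<in> space (\<Pi>\<^sub>M i\<in>S \<union> T. M). restrict x S \<in> A \<and> restrict x T \<in> B} \<in> sets (\<Pi>\<^sub>M i\<in>S \<union> T. M)"
    and "measure (\<Pi>\<^sub>M i\<in>S \<union> T. M) {x \<in> space (\<Pi>\<^sub>M i\<in>S \<union> T. M). restrict x S \<in> A \<and> restrict x T \<in> B}
      = measure (\<Pi>\<^sub>M i\<in>S. M) A * measure (\<Pi>\<^sub>M i\<in>T. M) B"
proof -
  interpret M: prob_space M by fact
  interpret product_sigma_finite "\<lambda>_. M" by standard
  let ?PS = "\<Pi>\<^sub>M i\<in>S. M" and ?PT = "\<Pi>\<^sub>M i\<in>T. M" and ?P = "\<Pi>\<^sub>M i\<in>S \<union> T. M"
  interpret PT: prob_space ?PT by (rule prob_space_PiM) (rule M.prob_space_axioms)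
  let ?R = "{x \<in> space ?P. restrict x S \<in> A \<and> restrict x T \<in> B}"
  have [measurable]: "(\<lambda>x. restrict x S) \<in> measurable ?P ?PS" "(\<lambda>x. restrict x T) \<in> measurable ?P ?PT"
    by (auto intro: measurable_restrict_subset)
  show R: "?R \<in> sets ?P" using A B by measurable
  have vimage: "merge S T -` ?R \<inter> space (?PS \<Otimes>\<^sub>M ?PT) = A \<times> B"
  proof -
    have "merge S T (x, y) \<in> space ?P" "restrict (merge S T (x, y)) S = x" "restrict (merge S T (x, y)) T = y"
      if "x \<in> space ?PS" "y \<in> space ?PT" for x y
      using measurable_space[OF measurable_merge, of "(x, y)" S "\<lambda>_. M" T] that ST(1)
      by (auto simp: space_pair_measure space_PiM PiE_def)
    then have "merge S T p \<in> ?R \<longleftrightarrow> p \<in> A \<times> B" if "p \<in> space ?PS \<times> space ?PT" for p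
      using that by (cases p) simp
    then show ?thesis
      using sets.sets_into_space[OF A] sets.sets_into_space[OF B]
      unfolding space_pair_measure by blast
  qed
  have "measure ?P ?R = measure (distr (?PS \<Otimes>\<^sub>M ?PT) ?P (merge S T)) ?R"
    by (simp add: distr_merge[OF ST])
  also have "\<dots> = measure (?PS \<Otimes>\<^sub>M ?PT) (A \<times> B)"
    using R unfolding vimage[symmetric] by (intro measure_distr measurable_merge)
  also have "\<dots> = measure ?PS A * measure ?PT B"
    using A B by (simp add: measure_def PT.emeasure_pair_measure_Times enn2real_mult)
  finally show "measure ?P ?R = measure ?PS A * measure ?PT B" .
qed


context exponential_right_tail
begin

abbreviation chains_below :: "real \<Rightarrow> nat set \<Rightarrow> real \<Rightarrow> (nat \<Rightarrow> real) set" where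
  "chains_below r I t \<equiv> {x \<in> space (\<Pi>\<^sub>M i\<in>I. M). (\<forall>i\<in>I. x i < - t) \<and> gap_free r (x ` I)}"

lemma pred_all_less:
  assumes "finite I" "J \<subseteq> I"
  shows "Measurable.pred (\<Pi>\<^sub>M i\<in>I. M) (\<lambda>x. \<forall>i\<in>J. x i < t)"
  using assms
  by (intro pred_intros_finite borel_measurable_pred_less borel_measurable_PiM_component sets_M
      borel_measurable_const) (auto intro: finite_subset)

lemma sets_chains_below: "finite I \<Longrightarrow> chains_below r I t \<in> sets (\<Pi>\<^sub>M i\<in>I. M)"
  using pred_all_less[of I I "- t"] by measurable

text \<open>
  A symmetric law is invariant under reflection, which exchanges chains above \<open>t\<close> with chains
  below \<open>- t\<close>.
\<close>

lemma measure_chains_below: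
  assumes sym: "\<And>y. f (- y) = f y" and I: "finite I"
  shows "measure (\<Pi>\<^sub>M i\<in>I. M) (chains_below r I t) = measure (\<Pi>\<^sub>M i\<in>I. M) (chains_above r I t)"
proof -
  let ?P = "\<Pi>\<^sub>M i\<in>I. M"
  have "distr M M uminus = distr M borel uminus"
    by (intro distr_cong) simp_all
  also have "\<dots> = density (distr lborel borel uminus) (\<lambda>t. ennreal (f t))"
    unfolding M_def by (subst density_distr) (simp_all add: sym)
  also have "\<dots> = M"
    by (simp add: lborel_distr_uminus M_def)
  finally have distr_M: "distr M M uminus = M" .
  have distr_P: "distr ?P ?P (compose I uminus) = ?P"
    using distr_PiM_finite_prob_space'[OF I, of "\<lambda>_. M" "\<lambda>_. M" uminus] prob_space_axioms
    by (simp add: distr_M)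
  have meas: "compose I uminus \<in> measurable ?P ?P"
    unfolding compose_def
    by (intro measurable_restrict) (auto cong: measurable_cong_sets
        intro!: borel_measurable_uminus borel_measurable_PiM_component)
  have "measure ?P (chains_above r I t) = measure (distr ?P ?P (compose I uminus)) (chains_above r I t)"
    by (simp add: distr_P)
  also have "\<dots> = measure ?P (compose I uminus -` chains_above r I t \<inter> space ?P)"
    using I by (intro measure_distr meas sets_chains_above)
  also have "compose I uminus -` chains_above r I t \<inter> space ?P = chains_below r I t"
  proof -
    have "compose I uminus x ` I = uminus ` (x ` I)" for x :: "nat \<Rightarrow> real"
      by (auto simp: compose_def image_image)
    then have "gap_free r (compose I uminus x ` I) = gap_free r (x ` I)" for x :: "nat \<Rightarrow> real"
      using I by (simp only: gap_free_uminus finite_imageI)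
    then show ?thesis
      using measurable_space[OF meas] by (auto simp: compose_def)
  qed
  finally show ?thesis ..
qed

text \<open>
  Here \<open>S\<close> is the set of the indices of the positive points. Almost surely no point is at the
  origin.
\<close>

lemma sum_over_sign_patterns:
  fixes r :: real and I :: "nat set"
  assumes I: "finite I"
  defines "W \<equiv> \<lambda>S. {x \<in> space (\<Pi>\<^sub>M i\<in>I. M). (\<forall>i\<in>S. 0 < x i) \<and> (\<forall>i\<in>I - S. x i < 0) \<and> gap_free r (x ` I)}"
  shows "measure (\<Pi>\<^sub>M i\<in>I. M) {x \<in> space (\<Pi>\<^sub>M i\<in>I. M). gap_free r (x ` I)}
      = (\<Sum>S\<in>Pow I. measure (\<Pi>\<^sub>M i\<in>I. M) (W S))"
    and "S \<subseteq> I \<Longrightarrow> W S \<in> sets (\<Pi>\<^sub>M i\<in>I. M)"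
proof -
  let ?P = "\<Pi>\<^sub>M i\<in>I. M"
  show W: "W S \<in> sets ?P" if "S \<subseteq> I" for S
  proof -
    note [measurable] = pred_all_less[OF I, of "I - S" 0] pred_all_greater[OF I that sets_M, of 0]
    show ?thesis unfolding W_def using I by measurable
  qed
  have "AE x in ?P. x i \<noteq> 0" if "i \<in> I" for i
    by (rule AE_PiM_component) (use prob_space_axioms that AE_M_neq in auto)
  then have "AE x in ?P. \<forall>i\<in>I. x i \<noteq> 0"
    using I by (intro AE_finite_allI) auto
  then have "AE x in ?P. x \<in> {x \<in> space ?P. gap_free r (x ` I)} \<longleftrightarrow> x \<in> (\<Union>S\<in>Pow I. W S)"
  proof (rule eventually_mono)
    fix x :: "nat \<Rightarrow> real" assume nz: "\<forall>i\<in>I. x i \<noteq> 0"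
    have "x \<in> W {i \<in> I. 0 < x i}" if "x \<in> space ?P" "gap_free r (x ` I)"
      using that nz by (auto simp: W_def not_less order.order_iff_strict)
    moreover have "{i \<in> I. 0 < x i} \<in> Pow I" by simp
    moreover have "x \<in> space ?P \<and> gap_free r (x ` I)" if "x \<in> W S" for S
      using that by (simp add: W_def)
    ultimately show "x \<in> {x \<in> space ?P. gap_free r (x ` I)} \<longleftrightarrow> x \<in> (\<Union>S\<in>Pow I. W S)"
      by blast
  qed
  then have "measure ?P {x \<in> space ?P. gap_free r (x ` I)} = measure ?P (\<Union>S\<in>Pow I. W S)"
    using I W by (intro measure_eq_AE) auto
  also have "\<dots> = (\<Sum>S\<in>Pow I. measure ?P (W S))"
  proof (rule P.finite_measure_finite_Union)
    show "disjoint_family_on W (Pow I)"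
      unfolding disjoint_family_on_def
    proof (intro ballI impI)
      fix S T assume "S \<in> Pow I" "T \<in> Pow I" "S \<noteq> T"
      then obtain i where i: "i \<in> I" "i \<in> S \<longleftrightarrow> i \<notin> T" by blast
      have "0 < x i \<longleftrightarrow> i \<in> U" if "x \<in> W U" for x U
        using that i(1) by (cases "i \<in> U") (auto simp: W_def dest: less_asym)
      then show "W S \<inter> W T = {}" using i(2) by blast
    qed
  qed (use I W in auto)
  finally show "measure ?P {x \<in> space ?P. gap_free r (x ` I)} = (\<Sum>S\<in>Pow I. measure ?P (W S))" .
qed

text \<open>
  For a fixed sign pattern, the positive and the negative points are independent. If all points form a
  chain, then so do both parts, which gives the upper bound. For the lower bound, both parts
  are required to be chains that start within distance \<open>r / 2\<close> of the origin. A part with \<open>k\<close> points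
  does so, given that it is a chain, with probability \<open>1 - s ^ k\<close>, since the distance of its first
  point from the origin has rate \<open>k * l\<close>. If one part is empty, this lower bound is \<open>0\<close>.
\<close>

lemma measure_sign_pattern_bounds:
  fixes I S :: "nat set"
  assumes sym: "\<And>y. f (- y) = f y"
    and r: "0 \<le> r" and q: "q = exp (- l * r)" and s: "s = exp (- l * (r / 2))"
    and I: "finite I" and S: "S \<subseteq> I"
  defines "W \<equiv> {x \<in> space (\<Pi>\<^sub>M i\<in>I. M). (\<forall>i\<in>S. 0 < x i) \<and> (\<forall>i\<in>I - S. x i < 0) \<and> gap_free r (x ` I)}"
    and "k \<equiv> card S" and "m \<equiv> card I - card S"
  shows "measure (\<Pi>\<^sub>M i\<in>I. M) W \<le> c ^ card I * (chain_prob q k * chain_prob q m)"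
    and "c ^ card I * (chain_prob q k * (1 - s ^ k) * (chain_prob q m * (1 - s ^ m))) \<le> measure (\<Pi>\<^sub>M i\<in>I. M) W"
proof -
  let ?P = "\<Pi>\<^sub>M i\<in>I. M"
  define T where "T = I - S"
  have ST: "S \<inter> T = {}" "finite S" "finite T" "I = S \<union> T"
    using S I finite_subset[OF S I] by (auto simp: T_def)
  have card: "card T = m" "card I = k + m"
    using S card_mono[OF I S] finite_subset[OF S I] by (simp_all add: T_def m_def k_def card_Diff_subset)
  have W_sets: "W \<in> sets ?P"
    unfolding W_def by (rule sum_over_sign_patterns(2)[OF I S])
  have above: "measure (\<Pi>\<^sub>M i\<in>S. M) (chains_above r S t) = c ^ k * chain_prob q k * exp (- l * t) ^ k"
    and below: "measure (\<Pi>\<^sub>M i\<in>T. M) (chains_below r T t) = c ^ m * chain_prob q m * exp (- l * t) ^ m"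
    if "0 \<le> t" for t
    using measure_chains_above[OF r q ST(2) that] measure_chains_above[OF r q ST(3) that]
      measure_chains_below[OF sym ST(3)] by (simp_all only: card k_def)
  define R where "R A B = {x \<in> space ?P. restrict x S \<in> A \<and> restrict x T \<in> B}" for A B
  have R: "R A B \<in> sets ?P" "measure ?P (R A B) = measure (\<Pi>\<^sub>M i\<in>S. M) A * measure (\<Pi>\<^sub>M i\<in>T. M) B"
    if "A \<in> sets (\<Pi>\<^sub>M i\<in>S. M)" "B \<in> sets (\<Pi>\<^sub>M i\<in>T. M)" for A B
    using measure_PiM_rectangle[OF prob_space_axioms ST(1-3) that] unfolding R_def ST(4) by auto
  have restr: "restrict x S \<in> space (\<Pi>\<^sub>M i\<in>S. M)" "restrict x T \<in> space (\<Pi>\<^sub>M i\<in>T. M)" for x :: "nat \<Rightarrow> real"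
    by (auto simp: space_PiM)
  have img: "restrict x S ` S = x ` S" "restrict x T ` T = x ` T" for x :: "nat \<Rightarrow> real"
    by auto
  have "W \<subseteq> R (chains_above r S 0) (chains_below r T 0)"
  proof
    fix x assume "x \<in> W"
    then have x: "x \<in> space ?P" "\<forall>i\<in>S. 0 < x i" "\<forall>i\<in>T. x i < 0" "gap_free r (x ` S \<union> x ` T)"
      by (auto simp: W_def T_def[symmetric] image_Un[symmetric] ST(4)[symmetric])
    then have "gap_free r (x ` S) \<and> gap_free r (x ` T)"
      using ST(2,3) by (intro gap_free_parts) auto
    then show "x \<in> R (chains_above r S 0) (chains_below r T 0)"
      using x restr[of x] by (simp add: R_def img)
  qed
  then have "measure ?P W \<le> measure ?P (R (chains_above r S 0) (chains_below r T 0))"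
    using ST R by (intro P.finite_measure_mono) (auto simp: sets_chains_below)
  also have "\<dots> = c ^ card I * (chain_prob q k * chain_prob q m)"
    unfolding R(2)[OF sets_chains_above[OF ST(2)] sets_chains_below[OF ST(3)]]
      above[OF order_refl] below[OF order_refl] card by (simp add: power_add)
  finally show "measure ?P W \<le> c ^ card I * (chain_prob q k * chain_prob q m)" .
  let ?A = "chains_above r S 0 - chains_above r S (r / 2)"
  let ?B = "chains_below r T 0 - chains_below r T (r / 2)"
  have sub: "R ?A ?B \<subseteq> W"
  proof
    fix x assume "x \<in> R ?A ?B"
    then have x: "x \<in> space ?P" "\<forall>i\<in>S. 0 < x i" "\<forall>i\<in>T. x i < 0" "gap_free r (x ` S)" "gap_free r (x ` T)"
      and "\<not> (\<forall>i\<in>S. r / 2 < x i)" "\<not> (\<forall>i\<in>T. x i < - (r / 2))"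
      using restr[of x] by (auto simp: R_def img)
    then obtain i j where "i \<in> S" "x i \<le> r / 2" "j \<in> T" "- (r / 2) \<le> x j"
      by (auto simp: not_less)
    then have "gap_free r (x ` S \<union> x ` T)"
      using x ST by (intro gap_free_union[of r "x ` S" "x i" "x ` T" "x j"]) auto
    then show "x \<in> W"
      using x by (simp add: W_def T_def[symmetric] image_Un[symmetric] ST(4)[symmetric])
  qed
  have A: "?A \<in> sets (\<Pi>\<^sub>M i\<in>S. M)"
    "measure (\<Pi>\<^sub>M i\<in>S. M) ?A = c ^ k * chain_prob q k * (1 - s ^ k)"
  proof -
    have "measure (\<Pi>\<^sub>M i\<in>S. M) ?A
        = measure (\<Pi>\<^sub>M i\<in>S. M) (chains_above r S 0) - measure (\<Pi>\<^sub>M i\<in>S. M) (chains_above r S (r / 2))"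
      using ST r by (intro P.finite_measure_Diff sets_chains_above) force+
    then show "measure (\<Pi>\<^sub>M i\<in>S. M) ?A = c ^ k * chain_prob q k * (1 - s ^ k)"
      using above[of 0] above[of "r / 2"] r by (simp only: s) (simp add: algebra_simps)
  qed (use ST in auto)
  have B: "?B \<in> sets (\<Pi>\<^sub>M i\<in>T. M)"
    "measure (\<Pi>\<^sub>M i\<in>T. M) ?B = c ^ m * chain_prob q m * (1 - s ^ m)"
  proof -
    have "measure (\<Pi>\<^sub>M i\<in>T. M) ?B
        = measure (\<Pi>\<^sub>M i\<in>T. M) (chains_below r T 0) - measure (\<Pi>\<^sub>M i\<in>T. M) (chains_below r T (r / 2))"
      using ST r by (intro P.finite_measure_Diff sets_chains_below) force+
    then show "measure (\<Pi>\<^sub>M i\<in>T. M) ?B = c ^ m * chain_prob q m * (1 - s ^ m)"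
      using below[of 0] below[of "r / 2"] r by (simp only: s) (simp add: algebra_simps)
  qed (use ST sets_chains_below in blast)
  have "c ^ card I * (chain_prob q k * (1 - s ^ k) * (chain_prob q m * (1 - s ^ m))) = measure ?P (R ?A ?B)"
    unfolding R(2)[OF A(1) B(1)] A(2) B(2) card by (simp add: power_add algebra_simps)
  also have "\<dots> \<le> measure ?P W"
    by (intro P.finite_measure_mono sub W_sets)
  finally show "c ^ card I * (chain_prob q k * (1 - s ^ k) * (chain_prob q m * (1 - s ^ m))) \<le> measure ?P W" .
qed

end

section \<open>The two random geometric graphs\<close>

lemma prob_rgg_connected_exponential:
  assumes l: "0 < l" and r: "0 \<le> r" and n: "0 < n"
  shows "prob_rgg_connected (exponential_density l) n r = chain_prob (exp (- l * r)) n"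
proof -
  interpret exponential_right_tail "exponential_density l" 1 l
  proof (rule exponential_right_tail.intro)
    show "prob_space (density lborel (\<lambda>t. ennreal (exponential_density l t)))"
      using prob_space_exponential_density[OF l] .
    show "exponential_density l y = 1 * (l * exp (- l * y))" if "0 < y" for y
      using that by (simp add: exponential_density_def mult.commute)
  qed (use l in auto)
  let ?P = "\<Pi>\<^sub>M i\<in>{1..n}. M"
  have "AE y in M. 0 < y"
    using AE_lborel_singleton[of 0] unfolding M_def
    by (subst AE_density) (auto simp: exponential_density_def elim!: eventually_mono)
  then have "AE x in ?P. 0 < x i" if "i \<in> {1..n}" for i
    using that prob_space_axioms by (intro AE_PiM_component) auto
  then have "AE x in ?P. \<forall>i\<in>{1..n}. 0 < x i"
    by (intro AE_finite_allI) auto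
  then have "measure ?P {x \<in> space ?P. gap_free r (x ` {1..n})} = measure ?P (chains_above r {1..n} 0)"
    by (intro measure_eq_AE sets_chains_above) (auto elim!: eventually_mono)
  then show ?thesis
    using r n by (simp add: prob_rgg_connected_eq_measure measure_chains_above)
qed

text \<open>
  Total mass \<open>1\<close> is obtained as one half from each side, the two halves being exchanged by
  reflection.
\<close>

lemma exponential_right_tail_double_exponential:
  assumes l: "0 < l"
  shows "exponential_right_tail (double_exponential_density l) (1 / 2) l"
proof (rule exponential_right_tail.intro)
  let ?f = "double_exponential_density l"
  show meas: "?f \<in> borel_measurable borel"
    unfolding double_exponential_density_def by measurable
  have pos: "(\<integral>\<^sup>+y. ennreal (?f y) * indicator {0<..} y \<partial>lborel) = ennreal (1 / 2)"
  proof -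
    have "(\<integral>\<^sup>+y. ennreal (?f y) * indicator {0<..} y \<partial>lborel)
        = (\<integral>\<^sup>+y. ennreal (l / 2 * exp (- l * y)) * indicator {0<..} y \<partial>lborel)"
      by (intro nn_integral_cong) (auto simp: double_exponential_density_def indicator_def)
    also have "\<dots> = ennreal (1 / 2)"
      using l by (subst nn_integral_exponential_tail) auto
    finally show ?thesis .
  qed
  have "(\<integral>\<^sup>+y. ennreal (?f y) * indicator {..<0} y \<partial>lborel)
      = (\<integral>\<^sup>+y. ennreal (?f y) * indicator {..<0} y \<partial>distr lborel borel uminus)"
    by (simp add: lborel_distr_uminus)
  also have "\<dots> = (\<integral>\<^sup>+y. ennreal (?f (- y)) * indicator {..<0} (- y) \<partial>lborel)"
    using meas by (subst nn_integral_distr) simp_all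
  also have "\<dots> = (\<integral>\<^sup>+y. ennreal (?f y) * indicator {0<..} y \<partial>lborel)"
    by (intro nn_integral_cong) (auto simp: double_exponential_density_def indicator_def)
  finally have neg: "(\<integral>\<^sup>+y. ennreal (?f y) * indicator {..<0} y \<partial>lborel) = ennreal (1 / 2)"
    by (simp add: pos)
  have "(\<integral>\<^sup>+y. ennreal (?f y) \<partial>lborel)
      = (\<integral>\<^sup>+y. ennreal (?f y) * indicator {0<..} y + ennreal (?f y) * indicator {..<0} y \<partial>lborel)"
    using AE_lborel_singleton[of 0]
    by (intro nn_integral_cong_AE) (auto simp: indicator_def elim!: eventually_mono)
  also have "\<dots> = ennreal (1 / 2) + ennreal (1 / 2)"
    using meas by (subst nn_integral_add) (simp_all add: pos neg)
  also have "\<dots> = 1"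
    by (subst ennreal_plus[symmetric]) auto
  finally have "(\<integral>\<^sup>+y. ennreal (?f y) \<partial>lborel) = 1" .
  then show "prob_space (density lborel (\<lambda>t. ennreal (?f t)))"
    using meas by (intro prob_spaceI) (simp add: emeasure_density)
qed (use l in \<open>auto simp: double_exponential_density_def\<close>)

text \<open>
  The bounds for a sign pattern depend only on the number \<open>k\<close> of positive points, so that summing
  over the patterns yields averages with respect to the binomial distribution.
\<close>

lemma prob_rgg_connected_double_exponential_bounds:
  assumes l: "0 < l" and r: "0 \<le> r" and n: "0 < n"
    and q: "q = exp (- l * r)" and s: "s = exp (- l * (r / 2))"
  shows "prob_rgg_connected (double_exponential_density l) n r
      \<le> (\<Sum>k\<le>n. real (n choose k) / 2 ^ n * (chain_prob q k * chain_prob q (n - k)))"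
    and "(\<Sum>k\<le>n. real (n choose k) / 2 ^ n *
        (chain_prob q k * (1 - s ^ k) * (chain_prob q (n - k) * (1 - s ^ (n - k)))))
      \<le> prob_rgg_connected (double_exponential_density l) n r"
proof -
  interpret exponential_right_tail "double_exponential_density l" "1 / 2" l
    by (rule exponential_right_tail_double_exponential[OF l])
  have sym: "double_exponential_density l (- y) = double_exponential_density l y" for y
    by (simp add: double_exponential_density_def)
  let ?I = "{1..n}"
  let ?U = "\<lambda>k. chain_prob q k * chain_prob q (n - k)"
  let ?L = "\<lambda>k. chain_prob q k * (1 - s ^ k) * (chain_prob q (n - k) * (1 - s ^ (n - k)))"
  have average: "(\<Sum>S\<in>Pow ?I. (1 / 2) ^ n * g (card S)) = (\<Sum>k\<le>n. real (n choose k) / 2 ^ n * g k)" for g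
    using sum_Pow_card[of ?I "\<lambda>k. (1 / 2) ^ n * g k"] by (simp add: power_one_over field_simps)
  have split: "prob_rgg_connected (double_exponential_density l) n r
      = (\<Sum>S\<in>Pow ?I. measure (\<Pi>\<^sub>M i\<in>?I. M) {x \<in> space (\<Pi>\<^sub>M i\<in>?I. M).
          (\<forall>i\<in>S. 0 < x i) \<and> (\<forall>i\<in>?I - S. x i < 0) \<and> gap_free r (x ` ?I)})"
    unfolding prob_rgg_connected_eq_measure[OF r n] by (rule sum_over_sign_patterns(1)) simp
  note bounds = measure_sign_pattern_bounds[OF sym r q s, of ?I, unfolded card_atLeastAtMost diff_Suc_1]
  have "prob_rgg_connected (double_exponential_density l) n r \<le> (\<Sum>S\<in>Pow ?I. (1 / 2) ^ n * ?U (card S))"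
    unfolding split by (intro sum_mono bounds(1)) auto
  then show "prob_rgg_connected (double_exponential_density l) n r \<le> (\<Sum>k\<le>n. real (n choose k) / 2 ^ n * ?U k)"
    unfolding average[of ?U] .
  have "(\<Sum>S\<in>Pow ?I. (1 / 2) ^ n * ?L (card S)) \<le> prob_rgg_connected (double_exponential_density l) n r"
    unfolding split by (intro sum_mono bounds(2)) auto
  then show "(\<Sum>k\<le>n. real (n choose k) / 2 ^ n * ?L k) \<le> prob_rgg_connected (double_exponential_density l) n r"
    unfolding average[of ?L] .
qed

theorem theorem1:
  fixes l r :: real
  assumes "l > 0" and "r > 0"
  shows "\<exists>Pc :: real. 0 < Pc \<and> Pc < 1 \<and>
    (\<lambda>n. prob_rgg_connected (exponential_density l) n r) \<longlonglongrightarrow> Pc \<and>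
    (\<lambda>n. prob_rgg_connected (double_exponential_density l) n r) \<longlonglongrightarrow> Pc\<^sup>2"
proof -
  define q where "q = exp (- l * r)"
  define s where "s = exp (- l * (r / 2))"
  have q: "0 < q" "q < 1" and s: "0 \<le> s" "s < 1"
    using assms by (auto simp: q_def s_def)
  obtain Pc where Pc: "0 < Pc" "Pc < 1" and lim: "chain_prob q \<longlonglongrightarrow> Pc"
    using chain_prob_LIMSEQ[OF q] .
  have pos: "\<forall>\<^sub>F n::nat in sequentially. 0 < n"
    by (rule eventually_gt_at_top)
  have "\<forall>\<^sub>F n in sequentially. chain_prob q n = prob_rgg_connected (exponential_density l) n r"
    using pos by eventually_elim (simp add: prob_rgg_connected_exponential q_def assms less_imp_le)
  then have "(\<lambda>n. prob_rgg_connected (exponential_density l) n r) \<longlonglongrightarrow> Pc"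
    by (rule Lim_transform_eventually[OF lim])
  moreover have "(\<lambda>n. prob_rgg_connected (double_exponential_density l) n r) \<longlonglongrightarrow> Pc\<^sup>2"
  proof (rule tendsto_sandwich)
    have "(\<lambda>k. chain_prob q k * (1 - s ^ k)) \<longlonglongrightarrow> Pc * (1 - 0)"
      using s by (intro tendsto_intros lim LIMSEQ_realpow_zero)
    then have lower: "(\<lambda>k. chain_prob q k * (1 - s ^ k)) \<longlonglongrightarrow> Pc" by simp
    show "(\<lambda>n. \<Sum>k\<le>n. real (n choose k) / 2 ^ n *
        (chain_prob q k * (1 - s ^ k) * (chain_prob q (n - k) * (1 - s ^ (n - k))))) \<longlonglongrightarrow> Pc\<^sup>2"
      unfolding power2_eq_square by (rule binomial_average_product[OF lower lower])
    show "(\<lambda>n. \<Sum>k\<le>n. real (n choose k) / 2 ^ n * (chain_prob q k * chain_prob q (n - k))) \<longlonglongrightarrow> Pc\<^sup>2"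
      unfolding power2_eq_square by (rule binomial_average_product[OF lim lim])
    note bounds = prob_rgg_connected_double_exponential_bounds[OF assms(1) less_imp_le[OF assms(2)] _ q_def s_def]
    show "\<forall>\<^sub>F n in sequentially. (\<Sum>k\<le>n. real (n choose k) / 2 ^ n *
        (chain_prob q k * (1 - s ^ k) * (chain_prob q (n - k) * (1 - s ^ (n - k)))))
        \<le> prob_rgg_connected (double_exponential_density l) n r"
      using pos by eventually_elim (rule bounds(2))
    show "\<forall>\<^sub>F n in sequentially. prob_rgg_connected (double_exponential_density l) n r
        \<le> (\<Sum>k\<le>n. real (n choose k) / 2 ^ n * (chain_prob q k * chain_prob q (n - k)))"
      using pos by eventually_elim (rule bounds(1))
  qed
  ultimately show ?thesis using Pc by blast
qed

end
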